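(* Let $(X,T,\mathcal{A},\mu)$ be a conservative ergodic measure preserving dynamical system, where $\mu$ is an infinite $\sigma$-finite measure. Then any uniformly returning set $A\in\mathcal{A}$ is uniform.
   Context: $\mathcal{P}_\mu$ denotes the set of probability measures $\nu$ on $\mathcal{A}$ with $\nu\ll\mu$; the same symbol is used for the set of the corresponding densities $d\nu/d\mu$. The transfer operator $\hat T:L_1(\mu)\to L_1(\mu)$ is the positive linear operator characterized by $\int_B\hat T(f)\,d\mu=\int_{T^{-1}(B)}f\,d\mu$ for all $f\in L_1(\mu)$, $B\in\mathcal{A}$. A set $A\in\mathcal{A}$ with $0<\mu(A)<\infty$ is uniform for $f\in\mathcal{P}_\mu$ if there is a sequence $(a_n)$ of positive reals such that $\frac1{a_n}\sum_{k=0}^{n-1}\hat T^k(f)\to1$ $\mu$-a.e. uniformly on $A$ (i.e. in $L_\infty$-norm on $A$). It is called uniform if it is uniform for some $f\in\mathcal{P}_\mu$. A set $A\in\mathcal{A}$ with $0<\mu(A)<\infty$ is uniformly returning for $f\in\mathcal{P}_\mu$ if there is a positive increasing sequence $(b_n)$ diverging to $\infty$ such that $b_n\hat T^n(f)\to1$ $\mu$-a.e. uniformly on $A$. It is called uniformly returning if it is uniformly returning for some $f\in\mathcal{P}_\mu$. *)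

theory Defs
  imports "HOL-Probability.Probability"
begin

definition measure_preserving :: "'a measure \<Rightarrow> ('a \<Rightarrow> 'a) \<Rightarrow> bool" where
  "measure_preserving M T \<longleftrightarrow>
     T \<in> measurable M M \<and> (\<forall>B\<in>sets M. emeasure M (T -` B \<inter> space M) = emeasure M B)"

text \<open>A measurable set is wandering if its iterated preimages (including itself) are pairwise
  disjoint; conservativity means that every wandering set is null.\<close>

definition wandering :: "'a measure \<Rightarrow> ('a \<Rightarrow> 'a) \<Rightarrow> 'a set \<Rightarrow> bool" where
  "wandering M T W \<longleftrightarrow>
     W \<in> sets M \<and> disjoint_family (\<lambda>n::nat. (T ^^ n) -` W \<inter> space M)"

definition conservative :: "'a measure \<Rightarrow> ('a \<Rightarrow> 'a) \<Rightarrow> bool" where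
  "conservative M T \<longleftrightarrow> (\<forall>W. wandering M T W \<longrightarrow> emeasure M W = 0)"

definition ergodic :: "'a measure \<Rightarrow> ('a \<Rightarrow> 'a) \<Rightarrow> bool" where
  "ergodic M T \<longleftrightarrow>
     (\<forall>B\<in>sets M. T -` B \<inter> space M = B \<longrightarrow> emeasure M B = 0 \<or> emeasure M (space M - B) = 0)"

definition ac_prob_measures :: "'a measure \<Rightarrow> 'a measure set" where
  "ac_prob_measures M = {\<nu>. prob_space \<nu> \<and> sets \<nu> = sets M \<and> absolutely_continuous M \<nu>}"

text \<open>Densities are real-valued functions, standing for their a.e. classes. The condition
  \<open>0 \<le> f x\<close> is needed because \<open>ennreal\<close> truncates negative values to \<open>0\<close>.\<close>

definition ac_prob_densities :: "'a measure \<Rightarrow> ('a \<Rightarrow> real) set" where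
  "ac_prob_densities M =
     {f \<in> borel_measurable M. (AE x in M. 0 \<le> f x) \<and>
        density M (\<lambda>x. ennreal (f x)) \<in> ac_prob_measures M}"

definition is_transfer ::
    "'a measure \<Rightarrow> ('a \<Rightarrow> 'a) \<Rightarrow> ('a \<Rightarrow> real) \<Rightarrow> ('a \<Rightarrow> real) \<Rightarrow> bool" where
  "is_transfer M T f g \<longleftrightarrow>
     integrable M g \<and>
     (\<forall>B\<in>sets M. (LINT x:B|M. g x) = (LINT x:(T -` B \<inter> space M)|M. f x))"

text \<open>The value is a chosen representative of an a.e. class; existence and a.e. uniqueness for
  integrable \<open>f\<close> are lemmas \<open>is_transfer_transfer_op\<close> and \<open>is_transfer_unique\<close>
  below. Outside \<open>L\<^sub>1\<close> the value is irrelevant.\<close>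

definition transfer_op ::
    "'a measure \<Rightarrow> ('a \<Rightarrow> 'a) \<Rightarrow> ('a \<Rightarrow> real) \<Rightarrow> ('a \<Rightarrow> real)" where
  "transfer_op M T f = (SOME g. is_transfer M T f g)"

text \<open>Uniform convergence on \<open>A\<close> off a null set; lemma \<open>ae_uniform_limit_iff_esssup\<close> below
  identifies it with convergence in the \<open>L\<^sub>\<infinity>\<close>-norm on \<open>A\<close>.\<close>

definition ae_uniform_limit ::
    "'a measure \<Rightarrow> 'a set \<Rightarrow> (nat \<Rightarrow> 'a \<Rightarrow> real) \<Rightarrow> ('a \<Rightarrow> real) \<Rightarrow> bool" where
  "ae_uniform_limit M A g h \<longleftrightarrow>
     (\<exists>N\<in>null_sets M. uniform_limit (A - N) g h sequentially)"

definition uniform_for ::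
    "'a measure \<Rightarrow> ('a \<Rightarrow> 'a) \<Rightarrow> ('a \<Rightarrow> real) \<Rightarrow> 'a set \<Rightarrow> bool" where
  "uniform_for M T f A \<longleftrightarrow>
     A \<in> sets M \<and> 0 < emeasure M A \<and> emeasure M A < \<infinity> \<and>
     (\<exists>a :: nat \<Rightarrow> real. (\<forall>n. 0 < a n) \<and>
        ae_uniform_limit M A
          (\<lambda>n x. 1 / a n * (\<Sum>k<n. (transfer_op M T ^^ k) f x)) (\<lambda>x. 1))"

definition uniform_set :: "'a measure \<Rightarrow> ('a \<Rightarrow> 'a) \<Rightarrow> 'a set \<Rightarrow> bool" where
  "uniform_set M T A \<longleftrightarrow> (\<exists>f\<in>ac_prob_densities M. uniform_for M T f A)"

definition uniformly_returning_for ::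
    "'a measure \<Rightarrow> ('a \<Rightarrow> 'a) \<Rightarrow> ('a \<Rightarrow> real) \<Rightarrow> 'a set \<Rightarrow> bool" where
  "uniformly_returning_for M T f A \<longleftrightarrow>
     A \<in> sets M \<and> 0 < emeasure M A \<and> emeasure M A < \<infinity> \<and>
     (\<exists>b :: nat \<Rightarrow> real. (\<forall>n. 0 < b n) \<and> incseq b \<and> filterlim b at_top sequentially \<and>
        ae_uniform_limit M A (\<lambda>n x. b n * (transfer_op M T ^^ n) f x) (\<lambda>x. 1))"

definition uniformly_returning :: "'a measure \<Rightarrow> ('a \<Rightarrow> 'a) \<Rightarrow> 'a set \<Rightarrow> bool" where
  "uniformly_returning M T A \<longleftrightarrow> (\<exists>f\<in>ac_prob_densities M. uniformly_returning_for M T f A)"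

lemma is_transfer_unique:
  assumes "is_transfer M T f g" "is_transfer M T f h"
  shows "AE x in M. g x = h x"
  using assms unfolding is_transfer_def by (intro density_unique_real) auto

lemma is_transfer_exists_nonneg:
  assumes "sigma_finite_measure M" "measure_preserving M T"
    and f: "integrable M f" and nonneg: "\<And>x. 0 \<le> f x"
  shows "\<exists>g. is_transfer M T f g"
proof -
  interpret sigma_finite_measure M by fact
  have T[measurable]: "T \<in> measurable M M"
    and pres: "\<And>B. B \<in> sets M \<Longrightarrow> emeasure M (T -` B \<inter> space M) = emeasure M B"
    using assms(2) by (auto simp: measure_preserving_def)
  have fm[measurable]: "f \<in> borel_measurable M" using f by auto
  define D where "D = density M (\<lambda>x. ennreal (f x))"
  define N where "N = distr D M T"
  have sD[measurable_cong, simp]: "sets D = sets M" "space D = space M" by (auto simp: D_def)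
  have sN[measurable_cong, simp]: "sets N = sets M" "space N = space M" by (auto simp: N_def)
  have TD[measurable]: "T \<in> measurable D M" by simp
  have emN: "emeasure N B = (\<integral>\<^sup>+x. ennreal (indicator (T -` B \<inter> space M) x * f x) \<partial>M)"
    if [measurable]: "B \<in> sets M" for B
  proof -
    have "emeasure N B = emeasure D (T -` B \<inter> space M)"
      by (simp add: N_def emeasure_distr)
    also have "\<dots> = (\<integral>\<^sup>+x. ennreal (f x) * indicator (T -` B \<inter> space M) x \<partial>M)"
      unfolding D_def by (rule emeasure_density) auto
    also have "\<dots> = (\<integral>\<^sup>+x. ennreal (indicator (T -` B \<inter> space M) x * f x) \<partial>M)"
      by (intro nn_integral_cong) (auto split: split_indicator)
    finally show ?thesis .
  qed
  have int: "integrable M (\<lambda>x. indicator (T -` B \<inter> space M) x * f x)" if [measurable]: "B \<in> sets M" for B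
    using integrable_mult_indicator[OF _ f, of "T -` B \<inter> space M"] by simp
  have emN': "emeasure N B = ennreal (LINT x:(T -` B \<inter> space M)|M. f x)"
    if "B \<in> sets M" for B
    unfolding emN[OF that] set_lebesgue_integral_def
    using nn_integral_eq_integral[OF int[OF that]] nonneg by simp
  have fin: "finite_measure N"
    by (intro finite_measureI) (simp add: emN')
  have ac: "absolutely_continuous M N"
    unfolding absolutely_continuous_def
  proof
    fix B assume B: "B \<in> null_sets M"
    then have BM[measurable]: "B \<in> sets M" by auto
    have "T -` B \<inter> space M \<in> null_sets M" using B pres[OF BM] by (auto simp: null_sets_def)
    then have "AE x in M. ennreal (indicator (T -` B \<inter> space M) x * f x) = 0"
      by (rule AE_not_in[THEN eventually_mono]) auto
    then have "emeasure N B = 0"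
      unfolding emN[OF BM] by (subst nn_integral_0_iff_AE) auto
    then show "B \<in> null_sets N" using BM by auto
  qed
  obtain g where gm[measurable]: "g \<in> borel_measurable M"
    and g: "AE x in M. RN_deriv M N x = ennreal (g x)" and g0: "\<And>x. 0 \<le> g x"
    using real_RN_deriv[OF fin ac sN(1)] by metis
  have emg: "emeasure N B = (\<integral>\<^sup>+x. ennreal (indicator B x * g x) \<partial>M)" if [measurable]: "B \<in> sets M" for B
  proof -
    have "emeasure N B = emeasure (density M (RN_deriv M N)) B"
      using density_RN_deriv[OF ac sN(1)] by simp
    also have "\<dots> = (\<integral>\<^sup>+x. RN_deriv M N x * indicator B x \<partial>M)"
      by (rule emeasure_density) auto
    also have "\<dots> = (\<integral>\<^sup>+x. ennreal (indicator B x * g x) \<partial>M)"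
      using g by (intro nn_integral_cong_AE) (auto elim!: eventually_mono split: split_indicator)
    finally show ?thesis .
  qed
  have gi: "integrable M g"
  proof (rule integrableI_nonneg)
    have "(\<integral>\<^sup>+x. ennreal (g x) \<partial>M) = (\<integral>\<^sup>+x. ennreal (indicator (space M) x * g x) \<partial>M)"
      by (intro nn_integral_cong) simp
    also have "\<dots> = emeasure N (space M)" by (rule emg[symmetric]) auto
    also have "\<dots> < \<infinity>" by (simp add: emN')
    finally show "(\<integral>\<^sup>+x. ennreal (g x) \<partial>M) < \<infinity>" .
  qed (use g0 in auto)
  have "(LINT x:B|M. g x) = (LINT x:(T -` B \<inter> space M)|M. f x)" if B[measurable]: "B \<in> sets M" for B
  proof -
    have "integrable M (\<lambda>x. indicator B x * g x)"
      using integrable_mult_indicator[OF B gi] by simp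
    from nn_integral_eq_integral[OF this] emg[OF B]
    have "emeasure N B = ennreal (LINT x:B|M. g x)"
      using g0 by (simp add: set_lebesgue_integral_def)
    moreover have "0 \<le> (LINT x:B|M. g x)" "0 \<le> (LINT x:(T -` B \<inter> space M)|M. f x)"
      unfolding set_lebesgue_integral_def using g0 nonneg by (auto intro!: integral_nonneg_AE)
    ultimately show ?thesis using emN'[OF B] by simp
  qed
  with gi show ?thesis unfolding is_transfer_def by blast
qed

lemma is_transfer_transfer_op:
  assumes "sigma_finite_measure M" "measure_preserving M T" and f: "integrable M f"
  shows "is_transfer M T f (transfer_op M T f)"
proof -
  have T[measurable]: "T \<in> measurable M M" using assms(2) by (auto simp: measure_preserving_def)
  let ?p = "\<lambda>x. max 0 (f x)" and ?m = "\<lambda>x. max 0 (- f x)"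
  have i: "integrable M ?p" "integrable M ?m" using f by auto
  obtain g where g: "is_transfer M T ?p g"
    using is_transfer_exists_nonneg[OF assms(1,2) i(1)] by auto
  obtain h where h: "is_transfer M T ?m h"
    using is_transfer_exists_nonneg[OF assms(1,2) i(2)] by auto
  have gh: "integrable M g" "integrable M h" using g h by (auto simp: is_transfer_def)
  have si: "set_integrable M B u" if "integrable M u" "B \<in> sets M" for B and u :: "'a \<Rightarrow> real"
    using integrable_mult_indicator[OF that(2,1)] by (simp add: set_integrable_def)
  have "(LINT x:B|M. g x - h x) = (LINT x:(T -` B \<inter> space M)|M. f x)" if B[measurable]: "B \<in> sets M" for B
  proof -
    have TB: "T -` B \<inter> space M \<in> sets M" by simp
    have "(LINT x:B|M. g x - h x) = (LINT x:B|M. g x) - (LINT x:B|M. h x)"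
      by (intro set_integral_diff si gh B)
    also have "\<dots> = (LINT x:(T -` B \<inter> space M)|M. ?p x) - (LINT x:(T -` B \<inter> space M)|M. ?m x)"
      using g h B by (simp add: is_transfer_def)
    also have "\<dots> = (LINT x:(T -` B \<inter> space M)|M. ?p x - ?m x)"
      by (intro set_integral_diff(2)[symmetric] si i TB)
    also have "(\<lambda>x. ?p x - ?m x) = f" by (auto simp: fun_eq_iff max_def)
    finally show ?thesis .
  qed
  with gh have "is_transfer M T f (\<lambda>x. g x - h x)" by (auto simp: is_transfer_def)
  then show ?thesis unfolding transfer_op_def by (rule someI[of "is_transfer M T f"])
qed

lemma ae_uniform_limit_iff_esssup:
  assumes A[measurable]: "A \<in> sets M" and pos: "0 < emeasure M A"
    and [measurable]: "\<And>n. g n \<in> borel_measurable M" "h \<in> borel_measurable M"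
  shows "ae_uniform_limit M A g h \<longleftrightarrow>
    (\<lambda>n. esssup (restrict_space M A) (\<lambda>x. ereal \<bar>g n x - h x\<bar>)) \<longlonglongrightarrow> 0"
proof -
  let ?R = "restrict_space M A"
  let ?d = "\<lambda>n x. ereal \<bar>g n x - h x\<bar>"
  have dm: "?d n \<in> borel_measurable ?R" for n
    by (intro measurable_restrict_space1) measurable
  have AA: "A \<inter> space M = A" using sets.sets_into_space[OF A] by auto
  have AE_R: "(AE x in ?R. P x) \<longleftrightarrow> (AE x in M. x \<in> A \<longrightarrow> P x)" for P
    by (rule AE_restrict_space_iff) (simp add: AA)
  have "emeasure ?R (space ?R) \<noteq> 0"
    using pos by (simp add: space_restrict_space AA emeasure_restrict_space)
  then have ess0: "0 \<le> esssup ?R (?d n)" for n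
    using esssup_AE_mono[of "\<lambda>x. 0::ereal" ?R "?d n"] esssup_const[of ?R "0::ereal"] by simp
  show ?thesis
  proof
    assume "ae_uniform_limit M A g h"
    then obtain N where N: "N \<in> null_sets M" and u: "uniform_limit (A - N) g h sequentially"
      by (auto simp: ae_uniform_limit_def)
    have ev: "\<forall>\<^sub>F n in sequentially. esssup ?R (?d n) \<le> ereal e" if "0 < e" for e
    proof -
      from u that have "\<forall>\<^sub>F n in sequentially. \<forall>x\<in>A - N. dist (g n x) (h x) < e"
        by (auto simp: uniform_limit_iff)
      then show ?thesis
      proof eventually_elim
        case (elim n)
        have "AE x in ?R. ?d n x \<le> ereal e"
          unfolding AE_R using AE_not_in[OF N] elim
          by (auto simp: dist_real_def intro: less_imp_le elim!: eventually_mono)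
        then show ?case by (intro esssup_I dm)
      qed
    qed
    show "(\<lambda>n. esssup ?R (?d n)) \<longlonglongrightarrow> 0"
    proof (rule order_tendstoI)
      fix a :: ereal assume "a < 0"
      then show "\<forall>\<^sub>F n in sequentially. a < esssup ?R (?d n)"
        using ess0 by (auto intro!: always_eventually elim: less_le_trans)
    next
      fix a :: ereal assume "0 < a"
      then obtain e where e: "0 < ereal e" "ereal e < a" using ereal_dense2 by blast
      then show "\<forall>\<^sub>F n in sequentially. esssup ?R (?d n) < a"
        using ev[of e] by (auto elim!: eventually_mono)
    qed
  next
    assume lim: "(\<lambda>n. esssup ?R (?d n)) \<longlonglongrightarrow> 0"
    have "AE x in ?R. \<forall>n. ?d n x \<le> esssup ?R (?d n)"
      by (simp add: AE_all_countable esssup_AE)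
    then have "AE x in M. x \<in> A \<longrightarrow> (\<forall>n. ?d n x \<le> esssup ?R (?d n))"
      by (simp only: AE_R)
    then obtain N where N: "N \<in> null_sets M"
      and le: "\<And>x. x \<in> space M - N \<Longrightarrow> x \<in> A \<longrightarrow> (\<forall>n. ?d n x \<le> esssup ?R (?d n))"
      by (rule AE_E3) blast
    have "uniform_limit (A - N) g h sequentially"
      unfolding uniform_limit_iff
    proof (intro allI impI)
      fix e :: real assume "0 < e"
      then have "\<forall>\<^sub>F n in sequentially. esssup ?R (?d n) < ereal e"
        using lim by (intro order_tendstoD) auto
      then show "\<forall>\<^sub>F n in sequentially. \<forall>x\<in>A - N. dist (g n x) (h x) < e"
      proof eventually_elim
        case (elim n)
        show ?case
        proof
          fix x assume "x \<in> A - N"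
          then have "?d n x \<le> esssup ?R (?d n)" using le[of x] AA by blast
          with elim have "?d n x < ereal e" by (rule le_less_trans[rotated])
          then show "dist (g n x) (h x) < e" by (simp add: dist_real_def)
        qed
      qed
    qed
    with N show "ae_uniform_limit M A g h" by (auto simp: ae_uniform_limit_def)
  qed
qed

end

theory Submission
  imports Defs
begin

text \<open>Let \<open>L\<close> be the transfer operator. If \<open>b\<^sub>n L\<^sup>n f\<close> tends to \<open>1\<close> uniformly on \<open>A\<close>, then
  summing shows that \<open>\<Sum>\<^sub>k\<^sub><\<^sub>n L\<^sup>k f\<close> is asymptotic to \<open>\<Sum>\<^sub>k\<^sub><\<^sub>n 1/b\<^sub>k\<close> uniformly on \<open>A\<close>, once two
  obstacles are removed. The first few \<open>L\<^sup>k f\<close> may be unbounded on \<open>A\<close>; they disappear when \<open>f\<close>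
  is replaced by \<open>L\<^sup>m f\<close>. And \<open>\<Sum>\<^sub>k 1/b\<^sub>k\<close> has to diverge: otherwise
  \<open>\<Sum>\<^sub>k \<integral>\<^sub>A L\<^sup>k f d\<mu> = \<Sum>\<^sub>k \<nu>(T\<^sup>-\<^sup>k A)\<close> is finite for \<open>\<nu> = f d\<mu>\<close>, so by
  Borel-Cantelli \<open>\<nu>\<close>-almost every point visits \<open>A\<close> only finitely often, against recurrence of the
  conservative ergodic map \<open>T\<close>.\<close>

section \<open>Recurrence of conservative and ergodic maps\<close>

lemma measure_preserving_funpow_null:
  assumes "measure_preserving M T" "W \<in> null_sets M"
  shows "(T ^^ n) -` W \<inter> space M \<in> null_sets M"
proof (induction n)
  case 0
  have "W \<inter> space M = W" using sets.sets_into_space[OF null_setsD2[OF assms(2)]] by auto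
  then show ?case using assms(2) by simp
next
  case (Suc n)
  have T: "T \<in> measurable M M" using assms(1) by (simp add: measure_preserving_def)
  have "(T ^^ Suc n) -` W \<inter> space M = T -` ((T ^^ n) -` W \<inter> space M) \<inter> space M"
    using measurable_space[OF T] by (auto simp: funpow_swap1)
  moreover have "T -` B \<inter> space M \<in> null_sets M" if "B \<in> null_sets M" for B
    using that T assms(1) by (auto simp: measure_preserving_def null_sets_def)
  ultimately show ?case using Suc by (simp only:)
qed

text \<open>The points \<open>W\<close> of \<open>A\<close> that never return to \<open>A\<close>
  form a wandering set, so \<open>W\<close> and all its preimages are null. A point of
  \<open>A\<close> with only finitely many visits lies in \<open>W\<close> at the time of its last
  visit, hence in one of these preimages.\<close>

lemma conservative_AE_recurrent:
  assumes mp: "measure_preserving M T" and cons: "conservative M T" and A[measurable]: "A \<in> sets M"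
  shows "AE x in M. x \<in> A \<longrightarrow> (\<exists>\<^sub>\<infinity>n. (T ^^ n) x \<in> A)"
proof -
  have T[measurable]: "T \<in> measurable M M" using mp by (simp add: measure_preserving_def)
  have Tn[measurable]: "T ^^ n \<in> measurable M M" for n by (rule measurable_compose_n[OF T])
  define W where "W = A - (\<Union>n. (T ^^ Suc n) -` A \<inter> space M)"
  have W[measurable]: "W \<in> sets M" unfolding W_def by measurable
  have no_return: "(T ^^ (j - i)) y \<notin> A" if "y \<in> W" "i < j" for i j y
  proof -
    have "y \<in> space M" using that(1) A W sets.sets_into_space by blast
    then show ?thesis using that(1) Suc_diff_Suc[OF that(2)] unfolding W_def by (metis DiffD2 IntI UN_I UNIV_I vimageI)
  qed
  have disj: False if "i < j" "(T ^^ i) x \<in> W" "(T ^^ j) x \<in> W" for i j x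
  proof -
    have "(T ^^ j) x = (T ^^ (j - i)) ((T ^^ i) x)"
      using that(1) by (metis comp_apply funpow_add le_add_diff_inverse2 less_imp_le_nat)
    then show False using no_return[OF that(2,1)] that(3) by (simp add: W_def)
  qed
  have "wandering M T W"
    unfolding wandering_def disjoint_family_on_def
    using W disj by (auto elim!: linorder_neqE_nat)
  then have "W \<in> null_sets M" using cons W by (auto simp: conservative_def)
  then have "AE x in M. \<forall>n. x \<notin> (T ^^ n) -` W \<inter> space M"
    by (intro AE_all_countable[THEN iffD2] allI AE_not_in measure_preserving_funpow_null[OF mp])
  with AE_space show ?thesis
  proof eventually_elim
    case (elim x)
    show ?case
    proof (intro impI, rule ccontr)
      assume x: "x \<in> A" and "\<not> (\<exists>\<^sub>\<infinity>n. (T ^^ n) x \<in> A)"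
      then have fin: "finite {n. (T ^^ n) x \<in> A}" by (simp add: INFM_iff_infinite)
      define m where "m = Max {n. (T ^^ n) x \<in> A}"
      have "0 \<in> {n. (T ^^ n) x \<in> A}" using x by simp
      then have m: "(T ^^ m) x \<in> A" using Max_in[OF fin] unfolding m_def by blast
      have "(T ^^ Suc k) ((T ^^ m) x) \<notin> A" for k
      proof
        assume "(T ^^ Suc k) ((T ^^ m) x) \<in> A"
        then have "Suc k + m \<in> {n. (T ^^ n) x \<in> A}" by (simp add: funpow_add)
        then have "Suc k + m \<le> m" unfolding m_def by (rule Max_ge[OF fin])
        then show False by simp
      qed
      with m have "(T ^^ m) x \<in> W" unfolding W_def by blast
      with elim show False by auto
    qed
  qed
qed

text \<open>Dropping the first point of an orbit does not change whether it visits \<open>A\<close>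
  infinitely often, so the set \<open>V\<close> of such points is strictly invariant and ergodicity
  makes it null or conull. It is not null, because it contains almost all of
  \<open>A\<close>.\<close>

lemma ergodic_AE_recurrent:
  assumes mp: "measure_preserving M T" and cons: "conservative M T" and erg: "ergodic M T"
    and A[measurable]: "A \<in> sets M" and pos: "0 < emeasure M A"
  shows "AE x in M. \<exists>\<^sub>\<infinity>n. (T ^^ n) x \<in> A"
proof -
  have T[measurable]: "T \<in> measurable M M" using mp by (simp add: measure_preserving_def)
  have Tn[measurable]: "T ^^ n \<in> measurable M M" for n by (rule measurable_compose_n[OF T])
  define V where "V = {x \<in> space M. \<exists>\<^sub>\<infinity>n. (T ^^ n) x \<in> A}"
  have V: "V \<in> sets M" unfolding V_def INFM_nat by measurable
  have "(\<exists>\<^sub>\<infinity>n. (T ^^ n) (T x) \<in> A) \<longleftrightarrow> (\<exists>\<^sub>\<infinity>n. (T ^^ n) x \<in> A)" for x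
    unfolding frequently_def
    using eventually_sequentially_Suc[of "\<lambda>n. (T ^^ n) x \<notin> A"]
    by (simp add: funpow_swap1 cofinite_eq_sequentially)
  then have "T -` V \<inter> space M = V"
    using measurable_space[OF T] by (auto simp: V_def)
  then have "emeasure M V = 0 \<or> emeasure M (space M - V) = 0"
    using erg V by (auto simp: ergodic_def)
  moreover have "emeasure M V \<noteq> 0"
  proof
    assume "emeasure M V = 0"
    then have "V \<in> null_sets M" using V by auto
    from AE_not_in[OF this] conservative_AE_recurrent[OF mp cons A] AE_space
    have "AE x in M. x \<notin> A" unfolding V_def by eventually_elim blast
    then have "emeasure M A = 0" using AE_iff_null_sets[OF A] by auto
    with pos show False by simp
  qed
  ultimately have "space M - V \<in> null_sets M" using V by auto
  from AE_not_in[OF this] AE_space show ?thesis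
    unfolding V_def by eventually_elim blast
qed

section \<open>Densities and iterates of the transfer operator\<close>

lemma ac_prob_densities_iff:
  "f \<in> ac_prob_densities M \<longleftrightarrow>
    integrable M f \<and> (AE x in M. 0 \<le> f x) \<and> (\<integral>x. f x \<partial>M) = 1"
proof (cases "f \<in> borel_measurable M \<and> (AE x in M. 0 \<le> f x)")
  case True
  then have [measurable]: "f \<in> borel_measurable M" and nn: "AE x in M. 0 \<le> f x" by auto
  have ac: "absolutely_continuous M (density M (\<lambda>x. ennreal (f x)))"
    by (rule absolutely_continuousI_density) simp
  have "emeasure (density M (\<lambda>x. ennreal (f x))) (space M) = (\<integral>\<^sup>+x. ennreal (f x) \<partial>M)"
    by (subst emeasure_density) (auto intro!: nn_integral_cong)
  then have "f \<in> ac_prob_densities M \<longleftrightarrow> (\<integral>\<^sup>+x. ennreal (f x) \<partial>M) = 1"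
    using True ac
    by (auto simp: ac_prob_densities_def ac_prob_measures_def intro!: prob_spaceI dest: prob_space.emeasure_space_1)
  also have "\<dots> \<longleftrightarrow> integrable M f \<and> (\<integral>x. f x \<partial>M) = 1"
    using nn_integral_eq_integrable[of f M 1] nn by auto
  finally show ?thesis using nn by simp
next
  case False
  then show ?thesis by (auto simp: ac_prob_densities_def)
qed

text \<open>Since \<open>transfer_op\<close> is a choice of representative, its iterates are
  accessible only through their integrals. Each application of the operator replaces the set of
  integration by its preimage under \<open>T\<close>.\<close>

lemma is_transfer_funpow:
  assumes "sigma_finite_measure M" "measure_preserving M T" "integrable M f"
  shows "is_transfer M (T ^^ n) f ((transfer_op M T ^^ n) f)"
proof (induction n)
  case 0
  have "B \<inter> space M = B" if "B \<in> sets M" for B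
    using sets.sets_into_space[OF that] by auto
  then show ?case using assms(3) by (simp add: is_transfer_def)
next
  case (Suc n)
  have T[measurable]: "T \<in> measurable M M" using assms(2) by (simp add: measure_preserving_def)
  let ?g = "(transfer_op M T ^^ n) f"
  have g: "integrable M ?g" using Suc by (simp add: is_transfer_def)
  have t: "is_transfer M T ?g (transfer_op M T ?g)"
    by (rule is_transfer_transfer_op[OF assms(1,2) g])
  have "(LINT x:B|M. transfer_op M T ?g x) = (LINT x:((T ^^ Suc n) -` B \<inter> space M)|M. f x)"
    if [measurable]: "B \<in> sets M" for B
  proof -
    have "(T ^^ n) -` (T -` B \<inter> space M) \<inter> space M = (T ^^ Suc n) -` B \<inter> space M"
      using measurable_space[OF measurable_compose_n[OF T]] by auto
    moreover have "T -` B \<inter> space M \<in> sets M" by measurable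
    ultimately show ?thesis using t Suc by (simp add: is_transfer_def)
  qed
  with t show ?case by (simp add: is_transfer_def del: funpow.simps(2)) (simp add: comp_def)
qed

text \<open>Over \<open>{g < 0}\<close> the integral of \<open>g\<close> equals an integral of
  \<open>f\<close>, so it is nonnegative and the set must be null; the whole space gives total mass
  one. As no choice of representative is involved, this applies directly to powers of a map.\<close>

lemma is_transfer_density:
  assumes T: "T \<in> measurable M M" and f: "f \<in> ac_prob_densities M" and g: "is_transfer M T f g"
  shows "g \<in> ac_prob_densities M"
proof -
  have [measurable]: "g \<in> borel_measurable M" and gi: "integrable M g" using g by (auto simp: is_transfer_def)
  have f0: "AE x in M. 0 \<le> f x" and f1: "(\<integral>x. f x \<partial>M) = 1"
    using f by (auto simp: ac_prob_densities_iff)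
  have int: "(LINT x:B|M. g x) = (LINT x:(T -` B \<inter> space M)|M. f x)" if "B \<in> sets M" for B
    using g that by (simp add: is_transfer_def)
  define B where "B = {x \<in> space M. g x < 0}"
  have B[measurable]: "B \<in> sets M" unfolding B_def by measurable
  have "0 \<le> (LINT x:B|M. g x)"
    unfolding int[OF B] unfolding set_lebesgue_integral_def
    using f0 by (intro integral_nonneg_AE) (auto elim!: eventually_mono)
  moreover have neg: "0 \<le> - (indicat_real B x *\<^sub>R g x)" for x
    by (auto simp: B_def indicator_def)
  moreover have i: "integrable M (\<lambda>x. - (indicat_real B x *\<^sub>R g x))"
    by (intro integrable_minus integrable_mult_indicator B gi)
  moreover have "0 \<le> (\<integral>x. - (indicat_real B x *\<^sub>R g x) \<partial>M)"
    using neg by (rule Bochner_Integration.integral_nonneg)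
  ultimately have "(\<integral>x. - (indicat_real B x *\<^sub>R g x) \<partial>M) = 0"
    unfolding set_lebesgue_integral_def by (simp only: Bochner_Integration.integral_minus)
  then have "AE x in M. - (indicat_real B x *\<^sub>R g x) = 0"
    using integral_nonneg_eq_0_iff_AE[OF i] neg by auto
  with AE_space have "AE x in M. 0 \<le> g x"
    by eventually_elim (auto simp: B_def indicator_def split: if_splits)
  moreover have "(\<integral>x. g x \<partial>M) = 1"
  proof -
    have "T -` space M \<inter> space M = space M" using measurable_space[OF T] by auto
    then show ?thesis using int[of "space M"] f1 f gi
      by (simp add: set_integral_space ac_prob_densities_iff)
  qed
  ultimately show ?thesis using gi by (simp add: ac_prob_densities_iff)
qed

text \<open>By duality the integrals are the probabilities under \<open>f d\<mu>\<close> of being in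
  \<open>A\<close> at time \<open>n\<close>, and almost sure recurrence forbids these to be
  summable.\<close>

lemma not_summable_transfer_integrals:
  assumes "sigma_finite_measure M" and mp: "measure_preserving M T"
    and "conservative M T" "ergodic M T"
    and A[measurable]: "A \<in> sets M" and "0 < emeasure M A" and f: "f \<in> ac_prob_densities M"
  shows "\<not> summable (\<lambda>n. LINT x:A|M. (transfer_op M T ^^ n) f x)"
proof
  assume sm: "summable (\<lambda>n. LINT x:A|M. (transfer_op M T ^^ n) f x)"
  have T[measurable]: "T \<in> measurable M M" using mp by (simp add: measure_preserving_def)
  have Tn[measurable]: "T ^^ n \<in> measurable M M" for n by (rule measurable_compose_n[OF T])
  have fi: "integrable M f" and f0: "AE x in M. 0 \<le> f x"
    using f by (auto simp: ac_prob_densities_iff)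
  have fm[measurable]: "f \<in> borel_measurable M" using fi by auto
  define \<nu> where "\<nu> = density M (\<lambda>x. ennreal (f x))"
  have \<nu>: "prob_space \<nu>" "absolutely_continuous M \<nu>" and [simp]: "sets \<nu> = sets M"
    using f by (auto simp: ac_prob_densities_def ac_prob_measures_def \<nu>_def)
  have [simp]: "space \<nu> = space M" by (simp add: \<nu>_def)
  interpret \<nu>: prob_space \<nu> by fact
  define V where "V n = (T ^^ n) -` A \<inter> space M" for n
  have V[measurable]: "V n \<in> sets M" for n unfolding V_def by measurable
  have "measure \<nu> (V n) = (LINT x:A|M. (transfer_op M T ^^ n) f x)" for n
  proof -
    have "measure \<nu> (V n) = (\<integral>x. indicator (V n) x \<partial>\<nu>)" using V[of n] sets.sets_into_space[OF V[of n]] by (simp add: Int_absorb1)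
    also have "\<dots> = (LINT x:V n|M. f x)"
      unfolding \<nu>_def set_lebesgue_integral_def
      by (subst integral_density) (auto simp: f0 mult.commute)
    also have "\<dots> = (LINT x:A|M. (transfer_op M T ^^ n) f x)"
      using is_transfer_funpow[OF assms(1) mp fi, of n] A by (simp add: is_transfer_def V_def)
    finally show ?thesis .
  qed
  then have "summable (\<lambda>n. measure \<nu> (V n))" using sm by simp
  then have "AE x in \<nu>. eventually (\<lambda>n. x \<in> space \<nu> - V n) sequentially"
    by (intro borel_cantelli_AE1) (auto simp: \<nu>.emeasure_eq_measure)
  \<comment> \<open>Absolute continuity carries recurrence from \<open>M\<close> to
    \<open>\<nu>\<close>; as \<open>\<nu>\<close> has mass one, the clash with Borel-Cantelli is a
    genuine contradiction.\<close>
  moreover have "AE x in \<nu>. \<exists>\<^sub>\<infinity>n. (T ^^ n) x \<in> A"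
    by (rule absolutely_continuous_AE[OF _ \<nu>(2) ergodic_AE_recurrent]) (use assms in auto)
  ultimately have "AE x in \<nu>. False"
    using AE_space
    by eventually_elim
      (auto simp: V_def frequently_def cofinite_eq_sequentially elim!: eventually_mono notE)
  then show False by simp
qed

section \<open>Summation of the uniform return asymptotics\<close>

theorem proposition1p1:
  fixes M :: "'a measure" and T :: "'a \<Rightarrow> 'a" and A :: "'a set"
  assumes "sigma_finite_measure M"
    and "emeasure M (space M) = \<infinity>"
    and "measure_preserving M T"
    and "conservative M T"
    and "ergodic M T"
    and "A \<in> sets M"
    and "uniformly_returning M T A"
  shows "uniform_set M T A"
proof -
  obtain f b N where f: "f \<in> ac_prob_densities M"
    and pos: "0 < emeasure M A" and fin: "emeasure M A < \<infinity>"
    and b: "\<And>n. 0 < b n" and N: "N \<in> null_sets M"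
    and lim: "uniform_limit (A - N) (\<lambda>n x. b n * (transfer_op M T ^^ n) f x) (\<lambda>x. 1) sequentially"
    using assms(7) unfolding uniformly_returning_def uniformly_returning_for_def ae_uniform_limit_def
    by blast
  note [measurable] = assms(6)
  define F where "F n = (transfer_op M T ^^ n) f" for n
  have T: "T \<in> measurable M M" using assms(3) by (simp add: measure_preserving_def)
  have fi: "integrable M f" using f by (simp add: ac_prob_densities_iff)
  have tr: "is_transfer M (T ^^ n) f (F n)" for n
    unfolding F_def by (rule is_transfer_funpow[OF assms(1,3) fi])
  have Fd: "F n \<in> ac_prob_densities M" for n
    by (rule is_transfer_density[OF measurable_compose_n[OF T] f tr])
  have close: "\<exists>m. \<forall>n\<ge>m. \<forall>x\<in>A - N. \<bar>b n * F n x - 1\<bar> < e" if "0 < e" for e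
    using lim that by (auto simp: uniform_limit_iff eventually_sequentially F_def dist_real_def)
  \<comment> \<open>Tolerance 1 already bounds \<open>F n\<close> by \<open>2 / b n\<close> on
    \<open>A - N\<close>. From here \<open>F m\<close> replaces \<open>f\<close>, and all indices
    are shifted by \<open>m\<close>.\<close>
  obtain m where m: "\<And>n x. m \<le> n \<Longrightarrow> x \<in> A - N \<Longrightarrow> \<bar>b n * F n x - 1\<bar> < 1"
    using close[of 1] by auto
  define c where "c k = 1 / b (k + m)" for k
  have c: "0 < c k" for k using b by (simp add: c_def)
  have dev: "\<bar>F (k + m) x - c k\<bar> \<le> e * c k" if "\<bar>b (k + m) * F (k + m) x - 1\<bar> < e" for e k x
  proof -
    have "F (k + m) x - c k = (b (k + m) * F (k + m) x - 1) * c k"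
      using b[of "k + m"] by (simp add: c_def field_simps)
    then show ?thesis using that c[of k] by (simp add: abs_mult)
  qed
  have dev1: "\<bar>F (k + m) x - c k\<bar> \<le> c k" if "x \<in> A - N" for k x
    using dev[of k x 1] m[of "k + m" x] that by simp
  have "\<not> summable c"
  proof
    assume "summable c"
    \<comment> \<open>By \<open>dev1\<close>, \<open>F (k + m)\<close> is at most
      \<open>2 * c k\<close> almost everywhere on \<open>A\<close>, which has finite measure;
      summability of \<open>c\<close> would thus pass to the integrals.\<close>
    have "(LINT x:A|M. F (k + m) x) \<le> 2 * measure M A * c k" for k
    proof -
      have Fi: "integrable M (F (k + m))" using Fd by (simp add: ac_prob_densities_iff)
      have "(LINT x:A|M. F (k + m) x) \<le> (LINT x:A|M. 2 * c k)"
        unfolding set_lebesgue_integral_def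
      proof (rule integral_mono_AE)
        show "AE x in M. indicat_real A x *\<^sub>R F (k + m) x \<le> indicat_real A x *\<^sub>R (2 * c k)"
          using AE_not_in[OF N]
        proof eventually_elim
          case (elim x)
          then show ?case using dev1[of x k] by (auto simp: indicator_def abs_le_iff)
        qed
      qed (use Fi fin in \<open>auto intro!: integrable_mult_indicator integrable_real_indicator
            integrable_mult_left[of "2 * c k"] simp: mult.commute simp del: real_scaleR_def\<close>)
      also have "\<dots> = 2 * measure M A * c k"
        using fin by (subst set_integral_const) (auto)
      finally show ?thesis .
    qed
    moreover have "0 \<le> (LINT x:A|M. F k x)" for k
      unfolding set_lebesgue_integral_def using Fd[of k]
      by (intro integral_nonneg_AE) (auto simp: ac_prob_densities_iff elim!: eventually_mono)
    ultimately have "summable (\<lambda>k. LINT x:A|M. F (k + m) x)"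
      by (intro summable_comparison_test'[OF summable_mult[OF \<open>summable c\<close>]]) auto
    then have "summable (\<lambda>k. LINT x:A|M. F k x)"
      by (simp add: summable_iff_shift[of "\<lambda>k. LINT x:A|M. F k x"])
    with not_summable_transfer_integrals[OF assms(1,3-6) pos f] show False by (simp add: F_def)
  qed
  define s where "s n = (\<Sum>k<n. c k)" for n
  have s_pos: "0 < s n" if "0 < n" for n
    unfolding s_def using that c by (intro sum_pos) auto
  have s_unbounded: "\<forall>\<^sub>F n in sequentially. B < s n" for B
  proof -
    have "\<not> (\<forall>n. s n \<le> B)"
      using \<open>\<not> summable c\<close> bounded_imp_summable[of c B] c unfolding s_def
      by (metis less_imp_le lessThan_Suc_atMost)
    then obtain n0 where "B < s n0" by (auto simp: not_le)
    moreover have "s n0 \<le> s n" if "n0 \<le> n" for n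
      unfolding s_def using that c by (intro sum_mono2) (auto intro: less_imp_le)
    ultimately show ?thesis unfolding eventually_sequentially by force
  qed
  \<comment> \<open>The empty sum \<open>s 0\<close> is 0, while a normalizing sequence has to be
    positive at every index.\<close>
  define a where "a n = (if n = 0 then 1 else s n)" for n
  have "uniform_limit (A - N) (\<lambda>n x. 1 / a n * (\<Sum>k<n. F (k + m) x)) (\<lambda>x. 1) sequentially"
    unfolding uniform_limit_iff
  proof (intro allI impI)
    fix e :: real assume e: "0 < e"
    obtain p where p: "\<And>n x. p \<le> n \<Longrightarrow> x \<in> A - N \<Longrightarrow> \<bar>b n * F n x - 1\<bar> < e / 2"
      using close[of "e / 2"] e by auto
    show "\<forall>\<^sub>F n in sequentially. \<forall>x\<in>A - N. dist (1 / a n * (\<Sum>k<n. F (k + m) x)) 1 < e"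
      \<comment> \<open>The threshold gives \<open>s p < e / 2 * s n\<close>, so the early terms use
        up at most half of the permitted error.\<close>
      using s_unbounded[of "2 * s p / e"] eventually_gt_at_top[of 0] eventually_ge_at_top[of p]
    proof eventually_elim
      case (elim n)
      show ?case
      proof
        fix x assume x: "x \<in> A - N"
        have "\<bar>(\<Sum>k<n. F (k + m) x) - s n\<bar> \<le> (\<Sum>k<n. \<bar>F (k + m) x - c k\<bar>)"
          unfolding s_def sum_subtractf[symmetric] by (rule sum_abs)
        \<comment> \<open>The first \<open>p\<close> terms have only the crude bound
          \<open>dev1\<close>; for \<open>k \<ge> p\<close> also \<open>k + m \<ge> p\<close>, and
          the fine bound holds. Keeping \<open>e / 2 * c k\<close> for every \<open>k\<close> makes
          the second part exactly \<open>e / 2 * s n\<close>.\<close>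
        also have "\<dots> \<le> (\<Sum>k<n. (if k < p then c k else 0) + e / 2 * c k)"
        proof (rule sum_mono)
          fix k
          show "\<bar>F (k + m) x - c k\<bar> \<le> (if k < p then c k else 0) + e / 2 * c k"
            using dev1[OF x, of k] dev[of k x "e / 2"] p[of "k + m", OF _ x] e c[of k]
            by (cases "k < p") (auto intro: add_increasing2)
        qed
        also have "\<dots> = s p + e / 2 * s n"
        proof -
          have "{..<n} \<inter> {..<p} = {..<p}" using elim(3) by auto
          then show ?thesis
            unfolding s_def
            by (simp add: sum.distrib sum_distrib_left sum.If_cases lessThan_def[symmetric])
        qed
        also have "\<dots> < e * s n"
          using elim(1) e by (simp add: field_simps)
        finally have *: "\<bar>(\<Sum>k<n. F (k + m) x) - s n\<bar> < e * s n" .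
        have "1 / s n * (\<Sum>k<n. F (k + m) x) - 1 = ((\<Sum>k<n. F (k + m) x) - s n) / s n"
          using s_pos[OF elim(2)] by (simp add: field_simps)
        then show "dist (1 / a n * (\<Sum>k<n. F (k + m) x)) 1 < e"
          using * s_pos[OF elim(2)] elim(2)
          by (simp add: a_def dist_real_def pos_divide_less_eq)
      qed
    qed
  qed
  \<comment> \<open>The shifted functions \<open>F (k + m)\<close> are the iterates of the density
    \<open>F m\<close>, which is the witness for uniformity.\<close>
  then have "ae_uniform_limit M A (\<lambda>n x. 1 / a n * (\<Sum>k<n. (transfer_op M T ^^ k) (F m) x)) (\<lambda>x. 1)"
    using N unfolding ae_uniform_limit_def F_def by (auto simp: funpow_add)
  moreover have "\<forall>n. 0 < a n" using s_pos by (simp add: a_def)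
  ultimately have "uniform_for M T (F m) A"
    unfolding uniform_for_def using assms(6) pos fin by blast
  then show ?thesis
    unfolding uniform_set_def using Fd by blast
qed

end
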